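(* Let $(S,T)$ be a connected bordered triangulated surface with vertex set $V$, and let $h\in\mathbb{R}$. Then the following statements hold. (a) If $r_1,r_2:V\to\mathbb{R}_{+}$ are two Euclidean circle packing metrics on $(S,T)$ with the same boundary value and the same $k_h$-curvature at every interior vertex, then $r_1=r_2$. (b) If $r_1,r_2:V\to\mathbb{R}_{+}$ are two hyperbolic circle packing metrics on $(S,T)$ with the same boundary value and the same $k_h$-curvature at every interior vertex, then $r_1=r_2$.
   Context: A bordered triangulated surface $(S,T)$ is a compact surface $S$ with non-empty boundary together with a (finite) triangulation $T$; $V$ is its set of vertices. A vertex is a boundary vertex if it belongs to the boundary of $S$, and an interior vertex otherwise; $V_{\partial}$ is the set of boundary vertices. A Euclidean (resp. hyperbolic) circle packing metric on $(S,T)$ is given by a function $r:V\to\mathbb{R}_{+}$: each edge $uv$ with end vertices $u,v$ is assigned length $d(uv)=r(u)+r(v)$, and each triangle of $T$ is given the geometry of the Euclidean (resp. hyperbolic) triangle with those edge lengths (the triangle inequalities hold automatically). The boundary value of $r$ is the restriction $r|_{V_{\partial}}$. For $h\in\mathbb{R}$ and an interior vertex $v$, let $\theta_1,\dots,\theta_m$ be all inner angles at $v$ of the triangles of $T$ incident to $v$. The $k_h$-curvature at $v$ is $$k_h(v)=\Big(2-\frac m2\Big)\pi-\sum_{i=1}^m\int_{\pi/2}^{\theta_i}\tan^h(t/2)\,dt.$$ *)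

theory Defs
  imports "HOL-Analysis.Analysis" "HOL-Homology.Simplices"
begin

section \<open>Compact surfaces with boundary\<close>

definition half_plane :: "complex set" where
  "half_plane = {z. 0 \<le> Im z}"

definition surface_chart :: "'a topology \<Rightarrow> 'a set \<Rightarrow> complex set \<Rightarrow> ('a \<Rightarrow> complex) \<Rightarrow> bool" where
  "surface_chart X U W f \<longleftrightarrow>
     openin X U \<and> openin (top_of_set half_plane) W \<and>
     homeomorphic_map (subtopology X U) (top_of_set W) f"

definition topological_surface :: "'a topology \<Rightarrow> bool" where
  "topological_surface X \<longleftrightarrow>
     Hausdorff_space X \<and> second_countable X \<and>
     (\<forall>x\<in>topspace X. \<exists>U W f. surface_chart X U W f \<and> x \<in> U)"

definition surface_boundary :: "'a topology \<Rightarrow> 'a set" where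
  "surface_boundary X =
     {x \<in> topspace X. \<exists>U W f. surface_chart X U W f \<and> x \<in> U \<and> Im (f x) = 0}"


section \<open>Triangulations\<close>

text \<open>
  A triangulation presents the space as finitely many triangles glued along edges and vertices. It is
  recorded by its characteristic maps, which are singular 2-simplices given in barycentric coordinates.
  The closed face carrying a point of the standard simplex is determined by its set of nonzero
  coordinates. The last condition says that two points are identified only if the closed faces carrying
  them are identified by a simplicial isomorphism (a permutation \<open>\<pi>\<close> of the coordinates) that matches
  the two points, and that no identification involves the interior of a triangle.

  Simplicial complexes are a special case; as usual for polyhedral surfaces, two sides of
  one triangle may be glued to each other, vertices of a triangle may coincide in the surface, and
  two triangles may share more than one edge.
\<close>

definition face_support :: "(nat \<Rightarrow> real) \<Rightarrow> nat set" where
  "face_support x = {i. x i \<noteq> 0}"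

definition surface_triangulation :: "'a topology \<Rightarrow> ((nat \<Rightarrow> real) \<Rightarrow> 'a) set \<Rightarrow> bool" where
  "surface_triangulation X T \<longleftrightarrow>
     finite T \<and>
     (\<forall>\<sigma>\<in>T. singular_simplex 2 X \<sigma>) \<and>
     topspace X = (\<Union>\<sigma>\<in>T. \<sigma> ` standard_simplex 2) \<and>
     (\<forall>\<sigma>\<in>T. \<forall>x\<in>standard_simplex 2. \<forall>y\<in>standard_simplex 2.
        face_support x = face_support y \<and> \<sigma> x = \<sigma> y \<longrightarrow> x = y) \<and>
     (\<forall>\<sigma>\<in>T. \<forall>\<tau>\<in>T. \<forall>x\<in>standard_simplex 2. \<forall>y\<in>standard_simplex 2. \<sigma> x = \<tau> y \<longrightarrow>
        (face_support x = {..2} \<longrightarrow> \<sigma> = \<tau>) \<and>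
        (\<exists>\<pi>. \<pi> permutes {..2} \<and> y = x \<circ> \<pi> \<and>
             (\<forall>z\<in>standard_simplex 2. face_support z \<subseteq> face_support x \<longrightarrow> \<sigma> z = \<tau> (z \<circ> \<pi>))))"

definition bordered_triangulated_surface ::
    "'a topology \<Rightarrow> ((nat \<Rightarrow> real) \<Rightarrow> 'a) set \<Rightarrow> bool" where
  "bordered_triangulated_surface X T \<longleftrightarrow>
     topological_surface X \<and> compact_space X \<and> surface_boundary X \<noteq> {} \<and>
     surface_triangulation X T"

definition tri_vertices :: "((nat \<Rightarrow> real) \<Rightarrow> 'a) set \<Rightarrow> 'a set" where
  "tri_vertices T = {simplicial_vertex i \<sigma> | i \<sigma>. \<sigma> \<in> T \<and> i \<le> 2}"

definition boundary_vertices :: "'a topology \<Rightarrow> ((nat \<Rightarrow> real) \<Rightarrow> 'a) set \<Rightarrow> 'a set" where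
  "boundary_vertices X T = tri_vertices T \<inter> surface_boundary X"

definition interior_vertices :: "'a topology \<Rightarrow> ((nat \<Rightarrow> real) \<Rightarrow> 'a) set \<Rightarrow> 'a set" where
  "interior_vertices X T = tri_vertices T - surface_boundary X"


section \<open>Angles of Euclidean and hyperbolic triangles\<close>

definition euclidean_angle_at :: "complex \<Rightarrow> complex \<Rightarrow> complex \<Rightarrow> real" where
  "euclidean_angle_at p q s = arccos ((q - p) \<bullet> (s - p) / (norm (q - p) * norm (s - p)))"

text \<open>The inner angle opposite the side of length \<open>a\<close> in a Euclidean triangle with sides \<open>a\<close>, \<open>b\<close>, \<open>c\<close>.\<close>

definition euclidean_angle :: "real \<Rightarrow> real \<Rightarrow> real \<Rightarrow> real" where
  "euclidean_angle a b c =
     (THE \<theta>. \<exists>p q s. dist q s = a \<and> dist p q = b \<and> dist p s = c \<and> \<theta> = euclidean_angle_at p q s)"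

text \<open>
  The hyperbolic plane is the upper sheet of the hyperboloid in Minkowski space; on its tangent
  spaces \<open>- minkowski\<close> is the Riemannian metric. The geodesic from \<open>p\<close> to \<open>q\<close> leaves
  \<open>p\<close> in the direction of \<open>q - minkowski p q *\<^sub>R p\<close>, the component of \<open>q\<close> orthogonal to \<open>p\<close>.
\<close>

fun minkowski :: "real \<times> real \<times> real \<Rightarrow> real \<times> real \<times> real \<Rightarrow> real" where
  "minkowski (t, x, y) (t', x', y') = t * t' - x * x' - y * y'"

definition hyperbolic_plane :: "(real \<times> real \<times> real) set" where
  "hyperbolic_plane = {p. minkowski p p = 1 \<and> 0 < fst p}"

definition hyperbolic_dist :: "real \<times> real \<times> real \<Rightarrow> real \<times> real \<times> real \<Rightarrow> real" where
  "hyperbolic_dist p q = arcosh (minkowski p q)"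

definition hyperbolic_angle_at ::
    "real \<times> real \<times> real \<Rightarrow> real \<times> real \<times> real \<Rightarrow> real \<times> real \<times> real \<Rightarrow> real" where
  "hyperbolic_angle_at p q s =
     (let u = q - minkowski p q *\<^sub>R p; w = s - minkowski p s *\<^sub>R p
      in arccos (- minkowski u w / (sqrt (- minkowski u u) * sqrt (- minkowski w w))))"

definition hyperbolic_angle :: "real \<Rightarrow> real \<Rightarrow> real \<Rightarrow> real" where
  "hyperbolic_angle a b c =
     (THE \<theta>. \<exists>p\<in>hyperbolic_plane. \<exists>q\<in>hyperbolic_plane. \<exists>s\<in>hyperbolic_plane.
        hyperbolic_dist q s = a \<and> hyperbolic_dist p q = b \<and> hyperbolic_dist p s = c \<and>
        \<theta> = hyperbolic_angle_at p q s)"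

text \<open>Both descriptions are well defined, with the values given by the laws of cosines.\<close>

lemma euclidean_angle_at_eq:
  "euclidean_angle_at p q s =
     arccos (((dist p q)\<^sup>2 + (dist p s)\<^sup>2 - (dist q s)\<^sup>2) / (2 * dist p q * dist p s))"
proof -
  have "(dist q s)\<^sup>2 = (norm ((q - p) - (s - p)))\<^sup>2"
    by (simp add: dist_norm)
  also have "\<dots> = (norm (q - p))\<^sup>2 + (norm (s - p))\<^sup>2 - 2 * ((q - p) \<bullet> (s - p))"
    unfolding power2_norm_eq_inner by (simp add: inner_diff inner_commute)
  finally have "(q - p) \<bullet> (s - p) = ((dist p q)\<^sup>2 + (dist p s)\<^sup>2 - (dist q s)\<^sup>2) / 2"
    by (simp add: dist_norm norm_minus_commute)
  then show ?thesis
    unfolding euclidean_angle_at_def by (simp only:) (simp add: dist_norm norm_minus_commute mult.assoc)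
qed

lemma euclidean_law_of_cosines:
  assumes "a > 0" "b > 0" "c > 0" "a < b + c" "b < a + c" "c < a + b"
  shows "euclidean_angle a b c = arccos ((b\<^sup>2 + c\<^sup>2 - a\<^sup>2) / (2 * b * c))"
proof -
  define k where "k = (b\<^sup>2 + c\<^sup>2 - a\<^sup>2) / (2 * b * c)"
  define t where "t = arccos k"
  have "(b - c)\<^sup>2 \<le> a\<^sup>2" "a\<^sup>2 \<le> (b + c)\<^sup>2"
    using assms by (auto simp: abs_le_square_iff [symmetric])
  then have "- (2 * b * c) \<le> b\<^sup>2 + c\<^sup>2 - a\<^sup>2" "b\<^sup>2 + c\<^sup>2 - a\<^sup>2 \<le> 2 * b * c"
    by (auto simp: power2_eq_square algebra_simps)
  then have "-1 \<le> k" "k \<le> 1"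
    unfolding k_def using assms by (auto simp: pos_le_divide_eq pos_divide_le_eq)
  then have t: "cos t = k" unfolding t_def by simp
  have n: "norm (complex_of_real b) = b" "norm (of_real c * cis t) = c"
    using assms by (auto simp: norm_mult)
  have "(dist (complex_of_real b) (of_real c * cis t))\<^sup>2 = a\<^sup>2"
  proof -
    have "(dist (complex_of_real b) (of_real c * cis t))\<^sup>2 = (b - c * cos t)\<^sup>2 + (c * sin t)\<^sup>2"
      by (simp add: dist_norm cmod_power2)
    also have "\<dots> = b\<^sup>2 + c\<^sup>2 * ((sin t)\<^sup>2 + (cos t)\<^sup>2) - 2 * b * c * cos t"
      by (simp only: power2_eq_square ring_distribs left_diff_distrib right_diff_distrib) simp
    also have "\<dots> = b\<^sup>2 + c\<^sup>2 - 2 * b * c * k"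
      by (simp only: sin_cos_squared_add mult_1_right flip: t)
    also have "\<dots> = a\<^sup>2"
      using assms(2,3) by (simp add: k_def)
    finally show ?thesis .
  qed
  then have ex: "dist (complex_of_real b) (of_real c * cis t) = a"
    using assms by (simp add: power2_eq_iff_nonneg)
  show ?thesis
    unfolding euclidean_angle_def
  proof (rule the_equality)
    show "\<exists>p q s. dist q s = a \<and> dist p q = b \<and> dist p s = c \<and>
        arccos ((b\<^sup>2 + c\<^sup>2 - a\<^sup>2) / (2 * b * c)) = euclidean_angle_at p q s"
      by (rule exI[of _ 0], rule exI[of _ "of_real b"], rule exI[of _ "of_real c * cis t"])
         (use ex n in \<open>simp add: euclidean_angle_at_eq\<close>)
  qed (auto simp: euclidean_angle_at_eq)
qed

lemma minkowski_ge_1: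
  assumes "p \<in> hyperbolic_plane" "q \<in> hyperbolic_plane"
  shows "minkowski p q \<ge> 1"
proof -
  obtain t x y where p: "p = (t, x, y)" by (cases p)
  obtain t' x' y' where q: "q = (t', x', y')" by (cases q)
  have t: "t\<^sup>2 = 1 + x\<^sup>2 + y\<^sup>2" "0 < t" and t': "t'\<^sup>2 = 1 + x'\<^sup>2 + y'\<^sup>2" "0 < t'"
    using assms by (auto simp: p q hyperbolic_plane_def power2_eq_square)
  have "(t * t')\<^sup>2 - (1 + x * x' + y * y')\<^sup>2 = (x - x')\<^sup>2 + (y - y')\<^sup>2 + (x * y' - y * x')\<^sup>2"
    unfolding power_mult_distrib t t' by (simp add: power2_eq_square algebra_simps)
  then have "(1 + x * x' + y * y')\<^sup>2 \<le> (t * t')\<^sup>2"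
    by (smt (verit) zero_le_power2)
  then have "1 + x * x' + y * y' \<le> t * t'"
    by (rule power2_le_imp_le) (simp add: less_imp_le t(2) t'(2))
  then show ?thesis by (simp add: p q)
qed

lemma minkowski_tangent:
  assumes "p \<in> hyperbolic_plane"
  shows "minkowski (q - minkowski p q *\<^sub>R p) (s - minkowski p s *\<^sub>R p) =
           minkowski q s - minkowski p q * minkowski p s"
proof -
  obtain t x y where p: "p = (t, x, y)" by (cases p)
  obtain t1 x1 y1 where q: "q = (t1, x1, y1)" by (cases q)
  obtain t2 x2 y2 where s: "s = (t2, x2, y2)" by (cases s)
  have 1: "t * t - x * x - y * y = 1"
    using assms by (simp add: p hyperbolic_plane_def)
  define A B where "A = t * t1 - x * x1 - y * y1" and "B = t * t2 - x * x2 - y * y2"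
  have "minkowski (q - minkowski p q *\<^sub>R p) (s - minkowski p s *\<^sub>R p) =
      (t1 - A * t) * (t2 - B * t) - (x1 - A * x) * (x2 - B * x) - (y1 - A * y) * (y2 - B * y)"
    by (simp add: p q s A_def B_def)
  also have "\<dots> = (t1 * t2 - x1 * x2 - y1 * y2) - A * B - A * B + A * B * (t * t - x * x - y * y)"
    unfolding A_def B_def by (simp add: algebra_simps)
  finally show ?thesis
    by (simp add: 1 p q s A_def B_def)
qed

lemma hyperbolic_angle_at_eq:
  assumes "p \<in> hyperbolic_plane" "q \<in> hyperbolic_plane" "s \<in> hyperbolic_plane"
  defines "a \<equiv> hyperbolic_dist q s" and "b \<equiv> hyperbolic_dist p q" and "c \<equiv> hyperbolic_dist p s"
  shows "hyperbolic_angle_at p q s =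
     arccos ((cosh b * cosh c - cosh a) / (sinh b * sinh c))"
proof -
  have m: "minkowski q s = cosh a" "minkowski p q = cosh b" "minkowski p s = cosh c"
    using minkowski_ge_1 assms(1-3) by (auto simp: a_def b_def c_def hyperbolic_dist_def)
  have n: "b \<ge> 0" "c \<ge> 0"
    using minkowski_ge_1 assms(1-3) by (auto simp: b_def c_def hyperbolic_dist_def)
  have 1: "minkowski q q = 1" "minkowski s s = 1"
    using assms by (auto simp: hyperbolic_plane_def)
  have r: "sqrt (cosh b * cosh b - 1) = sinh b" "sqrt (cosh c * cosh c - 1) = sinh c"
    using n cosh_square_eq[of b] cosh_square_eq[of c]
    by (simp_all add: power2_eq_square)
  show ?thesis
    unfolding hyperbolic_angle_at_def Let_def minkowski_tangent[OF assms(1)]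
    by (simp add: m 1 r)
qed

lemma hyperbolic_law_of_cosines:
  assumes "a > 0" "b > 0" "c > 0" "a < b + c" "b < a + c" "c < a + b"
  shows "hyperbolic_angle a b c = arccos ((cosh b * cosh c - cosh a) / (sinh b * sinh c))"
proof -
  define k where "k = (cosh b * cosh c - cosh a) / (sinh b * sinh c)"
  define t where "t = arccos k"
  have s0: "sinh b > 0" "sinh c > 0" using assms(2,3) by (simp_all only: sinh_real_pos_iff)
  have "cosh (b - c) \<le> cosh a" "cosh a \<le> cosh (b + c)"
  proof -
    have "cosh \<bar>b - c\<bar> \<le> cosh a"
      using assms by (subst cosh_real_nonneg_le_iff) linarith+
    then show "cosh (b - c) \<le> cosh a" by simp
    show "cosh a \<le> cosh (b + c)"
      using assms by (subst cosh_real_nonneg_le_iff) linarith+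
  qed
  then have "- (sinh b * sinh c) \<le> cosh b * cosh c - cosh a"
      "cosh b * cosh c - cosh a \<le> sinh b * sinh c"
    by (auto simp: cosh_add cosh_diff)
  then have "-1 \<le> k" "k \<le> 1"
    unfolding k_def using s0 by (auto simp: pos_le_divide_eq pos_divide_le_eq)
  then have t: "cos t = k" unfolding t_def by simp
  define P Q S :: "real \<times> real \<times> real" where "P = (1, 0, 0)" and "Q = (cosh b, sinh b, 0)"
    and "S = (cosh c, sinh c * cos t, sinh c * sin t)"
  have "sinh c * cos t * (sinh c * cos t) + sinh c * sin t * (sinh c * sin t) =
      (sinh c)\<^sup>2 * ((sin t)\<^sup>2 + (cos t)\<^sup>2)"
    by (simp only: power2_eq_square ring_distribs mult_ac add_ac)
  also have "\<dots> = (sinh c)\<^sup>2"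
    by (simp only: sin_cos_squared_add mult_1_right)
  finally have "minkowski S S = 1"
    using cosh_square_eq[of c] by (simp add: S_def power2_eq_square diff_diff_eq)
  moreover have "minkowski Q Q = 1"
    using cosh_square_eq[of b] by (simp add: Q_def power2_eq_square)
  ultimately have mem: "P \<in> hyperbolic_plane" "Q \<in> hyperbolic_plane" "S \<in> hyperbolic_plane"
    by (auto simp: hyperbolic_plane_def P_def Q_def S_def)
  have "minkowski Q S = cosh b * cosh c - sinh b * sinh c * cos t"
    by (simp add: Q_def S_def)
  also have "\<dots> = cosh a" using s0 by (simp add: t k_def)
  finally have d: "hyperbolic_dist Q S = a" "hyperbolic_dist P Q = b" "hyperbolic_dist P S = c"
    using assms by (auto simp: hyperbolic_dist_def arcosh_cosh_real P_def) (auto simp: Q_def S_def arcosh_cosh_real)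
  show ?thesis
    unfolding hyperbolic_angle_def
  proof (rule the_equality)
    show "\<exists>p\<in>hyperbolic_plane. \<exists>q\<in>hyperbolic_plane. \<exists>s\<in>hyperbolic_plane.
        hyperbolic_dist q s = a \<and> hyperbolic_dist p q = b \<and> hyperbolic_dist p s = c \<and>
        arccos ((cosh b * cosh c - cosh a) / (sinh b * sinh c)) = hyperbolic_angle_at p q s"
      using mem d by (intro bexI[of _ P] bexI[of _ Q] bexI[of _ S]) (auto simp: hyperbolic_angle_at_eq)
  qed (auto simp: hyperbolic_angle_at_eq)
qed


section \<open>Circle packing metrics and curvature\<close>

definition circle_packing_metric :: "((nat \<Rightarrow> real) \<Rightarrow> 'a) set \<Rightarrow> ('a \<Rightarrow> real) \<Rightarrow> bool" where
  "circle_packing_metric T r \<longleftrightarrow> (\<forall>v\<in>tri_vertices T. 0 < r v)"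

definition side_length :: "('a \<Rightarrow> real) \<Rightarrow> ((nat \<Rightarrow> real) \<Rightarrow> 'a) \<Rightarrow> nat \<Rightarrow> nat \<Rightarrow> real" where
  "side_length r \<sigma> i j = r (simplicial_vertex i \<sigma>) + r (simplicial_vertex j \<sigma>)"

text \<open>The argument \<open>ang\<close> is \<open>euclidean_angle\<close> or \<open>hyperbolic_angle\<close>.\<close>

definition corner_angle ::
    "(real \<Rightarrow> real \<Rightarrow> real \<Rightarrow> real) \<Rightarrow> ('a \<Rightarrow> real) \<Rightarrow> ((nat \<Rightarrow> real) \<Rightarrow> 'a) \<Rightarrow> nat \<Rightarrow> real" where
  "corner_angle ang r \<sigma> i =
     (let j = (i + 1) mod 3; k = (i + 2) mod 3
      in ang (side_length r \<sigma> j k) (side_length r \<sigma> i j) (side_length r \<sigma> i k))"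

definition corners_at :: "((nat \<Rightarrow> real) \<Rightarrow> 'a) set \<Rightarrow> 'a \<Rightarrow> (((nat \<Rightarrow> real) \<Rightarrow> 'a) \<times> nat) set" where
  "corners_at T v = {(\<sigma>, i). \<sigma> \<in> T \<and> i \<le> 2 \<and> simplicial_vertex i \<sigma> = v}"

text \<open>The interval integral is oriented: it changes sign when the angle is less than \<open>pi / 2\<close>.\<close>

definition k_curvature ::
    "(real \<Rightarrow> real \<Rightarrow> real \<Rightarrow> real) \<Rightarrow> ((nat \<Rightarrow> real) \<Rightarrow> 'a) set \<Rightarrow> real \<Rightarrow> ('a \<Rightarrow> real) \<Rightarrow> 'a \<Rightarrow> real" where
  "k_curvature ang T h r v =
     (2 - real (card (corners_at T v)) / 2) * pi
     - (\<Sum>(\<sigma>, i)\<in>corners_at T v.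
          LBINT t=ereal (pi / 2)..ereal (corner_angle ang r \<sigma> i). tan (t / 2) powr h)"

end

theory Submission
  imports Defs
begin

text \<open>
  The proof is a maximum principle. In both geometries the angle \<open>\<theta>\<close> at the circle of radius \<open>r\<close> in a
  triangle with radii \<open>r\<close>, \<open>s\<close>, \<open>t\<close> satisfies \<open>sin\<^sup>2 (\<theta>/2) = P x y * P x z\<close>, where \<open>x\<close>, \<open>y\<close>, \<open>z\<close> are the
  sizes of the three circles: the radii themselves in the Euclidean plane, their hyperbolic sines in the
  hyperbolic plane. The factor \<open>P x y\<close> increases strictly with \<open>y\<close>, and it does not increase when \<open>x\<close>
  and \<open>y\<close> are multiplied by the same number \<open>c \<ge> 1\<close>. The argument rests on these properties and is
  carried out for both geometries at once, in the locale \<open>packing_angle\<close>.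

  Let two packings have the same boundary value and the same curvature, and let \<open>c\<close> be the largest
  ratio of the sizes of the first packing to those of the second. Suppose that \<open>c > 1\<close>. A vertex where
  \<open>c\<close> is attained is interior. Multiplying the second packing by \<open>c\<close> makes none of its angles larger and
  makes it dominate the first packing, with equality at this vertex; so each angle at the vertex is at
  most as large in the first packing as in the second, and it is strictly smaller unless \<open>c\<close> is also
  attained at the other two vertices of the triangle. The curvature subtracts from a constant the sum of
  a strictly increasing function of the angles, whatever the exponent \<open>h\<close> is. Equality of the curvatures
  therefore forces equality of all the angles at the vertex, and \<open>c\<close> is attained at all its neighbours
  (\<open>radius_comparison\<close>).

  Two topological facts turn this into a contradiction. Any two vertices are linked by a chain of
  triangles, because the surface is connected (\<open>vertices_linked_by_triangles\<close>); and at least one vertex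
  lies on the boundary (\<open>boundary_vertex_exists\<close>). For the second fact, invariance of domain in the
  plane keeps the boundary out of the open triangles and shows that it is closed. If it met an open edge
  but contained neither end point, then near each of its points on the edge it would be an arc contained
  in the edge, hence a neighbourhood of the point in the edge by invariance of domain on the line; the
  boundary points of the edge would form a nonempty bounded set of parameters that is both open and
  closed in the line.
\<close>

section \<open>The boundary of a surface\<close>

text \<open>
  If the image contained a boundary point, a chart there would carry part of the image onto an open set
  of the plane, by invariance of domain; but an open set that meets the real axis does not stay in the
  half-plane. This separates the boundary from the interior both in a triangle and in a chart.
\<close>

lemma planar_image_misses_surface_boundary:
  fixes g :: "complex \<Rightarrow> 'a"
  assumes D: "open D" and g: "continuous_map (top_of_set D) X g" and inj: "inj_on g D"
  shows "g ` D \<inter> surface_boundary X = {}"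
proof (rule ccontr)
  assume "g ` D \<inter> surface_boundary X \<noteq> {}"
  then obtain z U W f where z: "z \<in> D" and ch: "surface_chart X U W f" and zU: "g z \<in> U"
    and im0: "Im (f (g z)) = 0"
    unfolding surface_boundary_def by auto
  from ch have U: "openin X U" and W: "openin (top_of_set half_plane) W"
    and f: "homeomorphic_map (subtopology X U) (top_of_set W) f"
    by (auto simp: surface_chart_def)
  define D' where "D' = {w \<in> D. g w \<in> U}"
  have "openin (top_of_set D) D'"
    using openin_continuous_map_preimage[OF g U] by (simp add: D'_def)
  with D have D': "open D'" by (metis openin_open_eq)
  have gU: "continuous_map (top_of_set D') (subtopology X U) g"
    by (rule continuous_map_into_subtopology)
       (use g in \<open>auto simp: D'_def intro: continuous_map_from_subtopology_mono\<close>)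
  have fc: "continuous_map (subtopology X U) (top_of_set W) f"
    using f by (rule homeomorphic_imp_continuous_map)
  have fg: "continuous_map (top_of_set D') (top_of_set W) (f \<circ> g)"
    using gU fc by (rule continuous_map_compose)
  then have "continuous_on D' (f \<circ> g)" and imW: "(f \<circ> g) ` D' \<subseteq> W"
    by (auto simp: continuous_map_in_subtopology)
  moreover have "inj_on (f \<circ> g) D'"
  proof (rule comp_inj_on)
    show "inj_on g D'" using inj by (rule inj_on_subset) (auto simp: D'_def)
    have "inj_on f (topspace X \<inter> U)"
      using homeomorphic_imp_injective_map[OF f] by simp
    then show "inj_on f (g ` D')"
      by (rule inj_on_subset) (use U openin_subset in \<open>auto simp: D'_def\<close>)
  qed
  ultimately have "open ((f \<circ> g) ` D')"
    using D' invariance_of_domain by blast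
  moreover have "z \<in> D'" using z zU by (simp add: D'_def)
  ultimately obtain e where e: "e > 0" "ball (f (g z)) e \<subseteq> (f \<circ> g) ` D'"
    by (metis (no_types, lifting) comp_apply image_eqI open_contains_ball)
  have "W \<subseteq> half_plane" using W openin_imp_subset by blast
  with e imW have "ball (f (g z)) e \<subseteq> half_plane" by blast
  moreover have "f (g z) - \<i> * of_real (e / 2) \<in> ball (f (g z)) e"
    using e(1) by (simp add: dist_norm norm_mult)
  ultimately have "f (g z) - \<i> * of_real (e / 2) \<in> half_plane" by blast
  then show False
    using e(1) im0 by (simp add: half_plane_def)
qed

lemma chart_inverse:
  assumes "surface_chart X U W f"
  obtains g where "continuous_map (top_of_set W) X g" "\<And>w. w \<in> W \<Longrightarrow> g w \<in> U \<and> f (g w) = w"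
    "\<And>x. x \<in> U \<Longrightarrow> f x \<in> W \<and> g (f x) = x"
proof -
  from assms have U: "U \<subseteq> topspace X" using openin_subset by (auto simp: surface_chart_def)
  from assms obtain g where g: "homeomorphic_maps (subtopology X U) (top_of_set W) f g"
    by (auto simp: surface_chart_def homeomorphic_map_maps)
  show thesis
  proof
    show "continuous_map (top_of_set W) X g"
      using g by (auto simp: homeomorphic_maps_def continuous_map_in_subtopology)
    show "g w \<in> U \<and> f (g w) = w" if "w \<in> W" for w
      using g that by (auto simp: homeomorphic_maps_def continuous_map_in_subtopology)
    show "f x \<in> W \<and> g (f x) = x" if "x \<in> U" for x
    proof -
      have "x \<in> topspace (subtopology X U)" using that U by auto
      moreover have "f ` (topspace X \<inter> U) \<subseteq> W"
        using g continuous_map_image_subset_topspace by (fastforce simp: homeomorphic_maps_def)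
      ultimately show ?thesis using g by (auto simp: homeomorphic_maps_def)
    qed
  qed
qed

text \<open>
  A point outside the boundary has a neighbourhood that a chart maps to the open half-plane. The inverse
  of the chart presents this neighbourhood as the injective image of an open planar set.
\<close>

lemma closedin_surface_boundary:
  assumes X: "topological_surface X"
  shows "closedin X (surface_boundary X)"
proof -
  have "openin X (topspace X - surface_boundary X)"
  proof (subst openin_subopen, intro ballI)
    fix x assume x: "x \<in> topspace X - surface_boundary X"
    then obtain U W f where ch: "surface_chart X U W f" and xU: "x \<in> U"
      using X by (auto simp: topological_surface_def)
    then have U: "openin X U" and W: "openin (top_of_set half_plane) W"
      and f: "continuous_map (subtopology X U) (top_of_set W) f"
      by (auto simp: surface_chart_def intro: homeomorphic_imp_continuous_map)
    obtain g where g: "continuous_map (top_of_set W) X g"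
      and gf: "\<And>w. w \<in> W \<Longrightarrow> g w \<in> U \<and> f (g w) = w" "\<And>x. x \<in> U \<Longrightarrow> f x \<in> W \<and> g (f x) = x"
      using chart_inverse[OF ch] by metis
    define W' where "W' = W \<inter> {w. 0 < Im w}"
    have "openin (top_of_set half_plane) W'"
      unfolding W'_def using W open_halfspace_Im_gt by (rule openin_Int_open)
    then have "openin (top_of_set {w. 0 < Im w}) W'"
      by (rule openin_subset_trans) (auto simp: W'_def half_plane_def)
    then have W': "open W'"
      using open_halfspace_Im_gt openin_open_eq by blast
    have "continuous_map (subtopology X U) euclidean f"
      using f by (simp add: continuous_map_in_subtopology)
    from openin_continuous_map_preimage[OF this, of "{w. 0 < Im w}"]
    have "openin (subtopology X U) {y \<in> topspace X \<inter> U. 0 < Im (f y)}"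
      using open_halfspace_Im_gt[of 0] by simp
    moreover have "topspace X \<inter> U = U" using openin_subset[OF U] by blast
    ultimately have V: "openin X {y \<in> U. 0 < Im (f y)}"
      using openin_open_subtopology[OF U] by auto
    have "g ` W' \<inter> surface_boundary X = {}"
    proof (rule planar_image_misses_surface_boundary[OF W'])
      show "continuous_map (top_of_set W') X g"
        using g by (rule continuous_map_from_subtopology_mono) (auto simp: W'_def)
      show "inj_on g W'"
        by (rule inj_on_inverseI[of _ f]) (use gf in \<open>auto simp: W'_def\<close>)
    qed
    moreover have "{y \<in> U. 0 < Im (f y)} \<subseteq> g ` W'"
    proof
      fix y assume "y \<in> {y \<in> U. 0 < Im (f y)}"
      then have "f y \<in> W'" "y = g (f y)" using gf(2)[of y] by (auto simp: W'_def)
      then show "y \<in> g ` W'" by blast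
    qed
    moreover have "0 < Im (f x)"
    proof -
      have "f x \<in> half_plane" using gf(2)[OF xU] W openin_imp_subset by blast
      moreover have "Im (f x) \<noteq> 0" using x ch xU by (auto simp: surface_boundary_def)
      ultimately show ?thesis by (simp add: half_plane_def)
    qed
    ultimately show "\<exists>V. openin X V \<and> x \<in> V \<and> V \<subseteq> topspace X - surface_boundary X"
      using V xU openin_subset[OF U] by (intro exI[of _ "{y \<in> U. 0 < Im (f y)}"]) blast
  qed
  then show ?thesis by (auto simp: closedin_def surface_boundary_def)
qed

text \<open>
  An arc cannot carry isolated pieces of the boundary: the boundary points on it would form a set of
  parameters that is closed and open in the line. It is open because a chart presents the boundary
  locally as an arc too, and continuous injective maps of an open interval into the line are open.
\<close>

lemma surface_boundary_misses_arc:
  assumes X: "topological_surface X"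
    and e: "continuous_map (top_of_set {0..1}) X e" and inj: "inj_on e {0<..<1::real}"
    and ends: "e 0 \<notin> surface_boundary X" "e 1 \<notin> surface_boundary X"
    and loc: "\<And>t. \<lbrakk>0 < t; t < 1; e t \<in> surface_boundary X\<rbrakk> \<Longrightarrow>
      \<exists>V. openin X V \<and> e t \<in> V \<and> V \<inter> surface_boundary X \<subseteq> e ` {0<..<1}"
  shows "e ` {0..1} \<inter> surface_boundary X = {}"
proof -
  let ?B = "surface_boundary X"
  define S where "S = {t \<in> {0..1}. e t \<in> ?B}"
  have haus: "Hausdorff_space X" using X by (simp add: topological_surface_def)
  have S01: "0 < t \<and> t < 1" if "t \<in> S" for t
    using that ends by (cases "t = 0 \<or> t = 1") (auto simp: S_def)
  have "closedin (top_of_set {0..1}) S"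
    using closedin_continuous_map_preimage[OF e closedin_surface_boundary[OF X]]
    by (simp add: S_def)
  then have "closed S" using closed_atLeastAtMost closedin_closed_trans by blast
  moreover have "open S"
  proof (subst open_subopen, intro ballI)
    fix t assume tS: "t \<in> S"
    then have t: "0 < t" "t < 1" and pB: "e t \<in> ?B" using S01 by (auto simp: S_def)
    \<comment> \<open>The arc may be a loop, and \<open>e\<close> is injective only on the open interval, so it is inverted
      on a compact interval \<open>{d..1 - d}\<close> around \<open>t\<close>; the image \<open>K\<close> of the rest stays away from \<open>e t\<close>.\<close>
    define d where "d = min t (1 - t) / 2"
    have d: "0 < d" "d < t" "t < 1 - d" using t by (auto simp: d_def min_def field_simps)
    define K where "K = e ` ({0..d} \<union> {1 - d..1})"
    have "compactin (top_of_set {0..1}) ({0..d} \<union> {1 - d..1})"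
      using d t by (auto simp: compactin_subtopology compact_Un)
    then have K: "closedin X K"
      unfolding K_def by (intro compactin_imp_closedin haus image_compactin[OF _ e])
    have pK: "e t \<notin> K"
    proof
      assume "e t \<in> K"
      then obtain u where u: "u \<in> {0..d} \<union> {1 - d..1}" "e t = e u"
        unfolding K_def by blast
      then have "u \<in> S" using pB d t by (auto simp: S_def)
      then have "u = t" using S01 u(2) inj t by (auto simp: inj_on_def)
      then show False using u(1) d by auto
    qed
    obtain V where V: "openin X V" "e t \<in> V" "V \<inter> ?B \<subseteq> e ` {0<..<1}"
      using loc[OF t pB] by blast
    obtain U W f where ch: "surface_chart X U W f" and pU: "e t \<in> U" and im0: "Im (f (e t)) = 0"
      using pB by (auto simp: surface_boundary_def)
    then have U: "openin X U" and W: "openin (top_of_set half_plane) W"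
      by (auto simp: surface_chart_def)
    obtain g where g: "continuous_map (top_of_set W) X g"
      and gf: "\<And>w. w \<in> W \<Longrightarrow> g w \<in> U \<and> f (g w) = w" "\<And>x. x \<in> U \<Longrightarrow> f x \<in> W \<and> g (f x) = x"
      using chart_inverse[OF ch] by metis
    define N where "N = {w \<in> W. g w \<in> V - K}"
    have "openin X (V - K)" using V K by blast
    from openin_continuous_map_preimage[OF g this] have "openin (top_of_set W) N"
      by (simp add: N_def)
    then have N: "openin (top_of_set half_plane) N"
      using W openin_trans by blast
    have "f (e t) \<in> N" using gf(2)[OF pU] V pK by (simp add: N_def)
    then obtain r where r: "r > 0" "ball (f (e t)) r \<inter> half_plane \<subseteq> N"
      using N by (metis openin_contains_ball)
    define a where "a = Re (f (e t))"
    \<comment> \<open>the boundary near \<open>e t\<close>, parametrised by the real axis of the chart\<close>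
    define c where "c = (\<lambda>x. g (complex_of_real x))"
    have fa: "f (e t) = of_real a" using im0 by (simp add: a_def complex_eq_iff)
    have cN: "of_real x \<in> N" if "x \<in> ball a r" for x
      using that r(2) unfolding fa
      by (auto simp: subset_iff half_plane_def dist_norm simp flip: of_real_diff)
    have cc: "continuous_map (top_of_set (ball a r)) X c"
    proof -
      have "continuous_map (top_of_set (ball a r)) (top_of_set W) complex_of_real"
        using cN by (auto simp: continuous_map_in_subtopology N_def intro!: continuous_intros)
      from continuous_map_compose[OF this g] show ?thesis by (simp add: c_def comp_def)
    qed
    have cinj: "inj_on c (ball a r)"
    proof (rule inj_onI)
      fix x y assume xy: "x \<in> ball a r" "y \<in> ball a r" "c x = c y"
      have "complex_of_real x = f (c x)" "complex_of_real y = f (c y)"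
        using cN[OF xy(1)] cN[OF xy(2)] gf(1) by (auto simp: N_def c_def)
      then show "x = y" using xy(3) of_real_eq_iff by metis
    qed
    define J where "J = {d..1 - d}"
    have cB: "c x \<in> ?B \<and> c x \<in> e ` J" if x: "x \<in> ball a r" for x
    proof -
      from cN[OF x] have w: "of_real x \<in> W" "c x \<in> V" "c x \<notin> K" by (auto simp: N_def c_def)
      from gf(1)[OF w(1)] have cU: "c x \<in> U" and "Im (f (c x)) = 0" by (simp_all add: c_def)
      moreover from cU have "c x \<in> topspace X" using openin_subset[OF U] by blast
      ultimately have B: "c x \<in> ?B" unfolding surface_boundary_def using ch by blast
      then obtain u where u: "u \<in> {0<..<1}" "c x = e u" using V w by blast
      moreover have "u \<in> J"
      proof (rule ccontr)
        assume "u \<notin> J"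
        then have "u \<in> {0..d} \<union> {1 - d..1}" using u(1) by (auto simp: J_def)
        then show False using u(2) w(3) unfolding K_def by blast
      qed
      ultimately show ?thesis using B by blast
    qed
    have J1: "J \<subseteq> {0<..<1}" using d by (auto simp: J_def)
    have "embedding_map (top_of_set J) X e"
    proof (rule continuous_imp_embedding_map)
      show "compact_space (top_of_set J)"
        by (simp add: J_def compact_space_subtopology)
      show "continuous_map (top_of_set J) X e"
        using e by (rule continuous_map_from_subtopology_mono) (use J1 in auto)
      show "inj_on e (topspace (top_of_set J))" using inj J1 by (auto intro: inj_on_subset)
    qed (rule haus)
    then obtain e' where e': "homeomorphic_maps (top_of_set J) (subtopology X (e ` J)) e e'"
      by (auto simp: embedding_map_def homeomorphic_map_maps)
    then have e'c: "continuous_map (subtopology X (e ` J)) (top_of_set J) e'"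
      and ee': "\<And>y. y \<in> e ` J \<Longrightarrow> e' y \<in> J \<and> e (e' y) = y"
      and e'e: "\<And>u. u \<in> J \<Longrightarrow> e' (e u) = u"
      by (auto simp: homeomorphic_maps_def)
    \<comment> \<open>the passage from the parameter of the boundary to the parameter of the arc\<close>
    define s where "s = e' \<circ> c"
    have "continuous_map (top_of_set (ball a r)) (subtopology X (e ` J)) c"
      using cc cB by (auto intro!: continuous_map_into_subtopology)
    then have "continuous_map (top_of_set (ball a r)) (top_of_set J) s"
      unfolding s_def using e'c by (rule continuous_map_compose)
    then have "continuous_on (ball a r) s" by (simp add: continuous_map_in_subtopology)
    moreover have es: "e (s x) = c x \<and> s x \<in> J" if "x \<in> ball a r" for x
      using cB[OF that] ee' by (simp add: s_def)
    then have "inj_on s (ball a r)"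
      by (intro inj_onI) (metis cinj inj_onD)
    ultimately have "open (s ` ball a r)" by (intro invariance_of_domain) auto
    moreover have "t \<in> s ` ball a r"
    proof
      show "a \<in> ball a r" using r by simp
      have "c a = e t" using gf(2)[OF pU] fa by (simp add: c_def)
      moreover have "t \<in> J" using d by (simp add: J_def)
      ultimately show "t = s a" using e'e by (simp add: s_def)
    qed
    moreover have "s ` ball a r \<subseteq> S"
    proof (intro image_subsetI)
      fix x assume x: "x \<in> ball a r"
      then show "s x \<in> S" using es[OF x] cB[OF x] d by (simp add: S_def J_def)
    qed
    ultimately show "\<exists>T. open T \<and> t \<in> T \<and> T \<subseteq> S" by blast
  qed
  ultimately have "S = {} \<or> S = UNIV" using clopen by blast
  moreover have "2 \<notin> S" by (simp add: S_def)
  ultimately have "S = {}" by blast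
  then show ?thesis by (auto simp: S_def)
qed

section \<open>Triangles and edges in barycentric coordinates\<close>

lemma standard_simplex_2_iff:
  "x \<in> standard_simplex 2 \<longleftrightarrow>
     0 \<le> x 0 \<and> 0 \<le> x 1 \<and> 0 \<le> x 2 \<and> (\<forall>i>2. x i = 0) \<and> x 0 + x 1 + x 2 = 1"
proof -
  have sum: "(\<Sum>i\<le>2. x i) = x 0 + x 1 + x 2" by (simp add: numeral_2_eq_2)
  have "0 \<le> x i \<and> x i \<le> 1"
    if "0 \<le> x 0" "0 \<le> x 1" "0 \<le> x 2" "\<forall>i>2. x i = 0" "x 0 + x 1 + x 2 = 1" for i
  proof -
    consider "i = 0" | "i = 1" | "i = 2" | "i > 2" by linarith
    then show ?thesis using that by cases auto
  qed
  then show ?thesis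
    unfolding standard_simplex_def mem_Collect_eq sum by blast
qed

lemma face_support_subset: "x \<in> standard_simplex p \<Longrightarrow> face_support x \<subseteq> {..p}"
  unfolding standard_simplex_def face_support_def by (auto simp: not_le[symmetric])

lemma standard_simplex_permute:
  assumes "x \<in> standard_simplex p" "\<pi> permutes {..p}"
  shows "x \<circ> \<pi> \<in> standard_simplex p"
proof -
  have "sum (x \<circ> \<pi>) {..p} = sum x {..p}"
    using assms(2) by (metis sum.permute)
  then show ?thesis
    using assms permutes_not_in[OF assms(2)] by (auto simp: standard_simplex_def)
qed

definition edge_point :: "nat \<Rightarrow> nat \<Rightarrow> real \<Rightarrow> nat \<Rightarrow> real" where
  "edge_point i j t = (\<lambda>m. if m = i then 1 - t else if m = j then t else 0)"

lemma edge_point_in_simplex: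
  assumes "i \<le> 2" "j \<le> 2" "i \<noteq> j" "t \<in> {0..1}"
  shows "edge_point i j t \<in> standard_simplex 2"
proof -
  have "i = 0 \<or> i = 1 \<or> i = 2" "j = 0 \<or> j = 1 \<or> j = 2" using assms by auto
  then show ?thesis
    using assms by (auto simp: standard_simplex_2_iff edge_point_def)
qed

lemma face_support_edge_point:
  "i \<noteq> j \<Longrightarrow> 0 < t \<Longrightarrow> t < 1 \<Longrightarrow> face_support (edge_point i j t) = {i, j}"
  by (auto simp: face_support_def edge_point_def)

lemma edge_point_of_support:
  assumes "x \<in> standard_simplex 2" "face_support x \<subseteq> {i, j}" "i \<le> 2" "j \<le> 2" "i \<noteq> j"
  shows "x = edge_point i j (x j)" "x j \<in> {0..1}"
proof -
  have ij: "i = 0 \<or> i = 1 \<or> i = 2" "j = 0 \<or> j = 1 \<or> j = 2" using assms by auto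
  have z: "x m = 0" if "m \<noteq> i" "m \<noteq> j" for m
    using that assms(2) by (auto simp: face_support_def)
  have "x i = 1 - x j"
    using assms(1,5) ij z[of 0] z[of 1] z[of 2] by (auto simp: standard_simplex_2_iff)
  then show "x = edge_point i j (x j)"
    using z by (auto simp: edge_point_def fun_eq_iff)
  show "x j \<in> {0..1}" using assms(1) by (auto simp: standard_simplex_def)
qed

lemma edge_point_ends:
  "\<sigma> (edge_point i j 0) = simplicial_vertex i \<sigma>"
  "i \<noteq> j \<Longrightarrow> \<sigma> (edge_point i j 1) = simplicial_vertex j \<sigma>"
proof -
  have "edge_point i j 0 = (\<lambda>m. if m = i then 1 else 0)" by (auto simp: edge_point_def)
  then show "\<sigma> (edge_point i j 0) = simplicial_vertex i \<sigma>" by (simp add: simplicial_vertex_def)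
  assume "i \<noteq> j"
  then have "edge_point i j 1 = (\<lambda>m. if m = j then 1 else 0)" by (auto simp: edge_point_def)
  then show "\<sigma> (edge_point i j 1) = simplicial_vertex j \<sigma>" by (simp add: simplicial_vertex_def)
qed

lemma triangulation_continuous:
  assumes "surface_triangulation X T" "\<sigma> \<in> T"
  shows "continuous_map (subtopology (powertop_real UNIV) (standard_simplex 2)) X \<sigma>"
  using assms by (auto simp: surface_triangulation_def singular_simplex_def)

lemma triangulation_inj:
  assumes "surface_triangulation X T" "\<sigma> \<in> T" "x \<in> standard_simplex 2" "y \<in> standard_simplex 2"
    "face_support x = face_support y" "\<sigma> x = \<sigma> y"
  shows "x = y"
  using assms by (simp add: surface_triangulation_def)

lemma triangulation_glue:
  assumes "surface_triangulation X T" "\<sigma> \<in> T" "\<tau> \<in> T"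
    "x \<in> standard_simplex 2" "y \<in> standard_simplex 2" "\<sigma> x = \<tau> y"
  obtains \<pi> where "\<pi> permutes {..2}" "y = x \<circ> \<pi>"
    "\<And>z. z \<in> standard_simplex 2 \<Longrightarrow> face_support z \<subseteq> face_support x \<Longrightarrow> \<sigma> z = \<tau> (z \<circ> \<pi>)"
  using assms unfolding surface_triangulation_def by metis

lemma closedin_triangle_image:
  assumes "Hausdorff_space X" "surface_triangulation X T" "\<sigma> \<in> T"
    "closedin (powertop_real UNIV) C" "C \<subseteq> standard_simplex 2"
  shows "closedin X (\<sigma> ` C)"
proof -
  have "compactin (powertop_real UNIV) C"
    using closed_compactin[OF compactin_standard_simplex assms(5,4)] .
  then have "compactin (subtopology (powertop_real UNIV) (standard_simplex 2)) C"
    using assms(5) by (simp add: compactin_subtopology)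
  then show ?thesis
    using image_compactin triangulation_continuous[OF assms(2,3)] compactin_imp_closedin assms(1)
    by blast
qed

section \<open>Boundary vertices and connectedness of the triangulation\<close>

text \<open>
  Two barycentric coordinates present the open triangle as an injective image of an open planar set.
\<close>

lemma open_triangle_misses_surface_boundary:
  assumes tri: "surface_triangulation X T" and s: "\<sigma> \<in> T"
    and x: "x \<in> standard_simplex 2" "face_support x = {..2}"
  shows "\<sigma> x \<notin> surface_boundary X"
proof -
  define D where "D = {z. 0 < Re z} \<inter> {z. 0 < Im z} \<inter> {z. Re z + Im z < 1}"
  define p where "p = (\<lambda>z m. if m = 0 then Re z else if m = 1 then Im z
                        else if m = (2::nat) then 1 - Re z - Im z else 0)"
  have pS: "p z \<in> standard_simplex 2 \<and> face_support (p z) = {..2}" if "z \<in> D" for z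
    using that by (auto simp: D_def p_def standard_simplex_2_iff face_support_def split: if_splits)
  have "open D"
    unfolding D_def by (intro open_Int open_Collect_less continuous_intros)
  moreover have "continuous_map (top_of_set D) X (\<sigma> \<circ> p)"
  proof (rule continuous_map_compose[OF _ triangulation_continuous[OF tri s]])
    have "continuous_map (top_of_set D) euclideanreal (\<lambda>z. p z m)" for m
      unfolding p_def
      by (cases "m = 0"; cases "m = 1"; cases "m = 2") (auto intro!: continuous_intros)
    then show "continuous_map (top_of_set D) (subtopology (powertop_real UNIV) (standard_simplex 2)) p"
      using pS by (auto simp: continuous_map_in_subtopology continuous_map_componentwise_UNIV)
  qed
  moreover have "inj_on (\<sigma> \<circ> p) D"
  proof (rule inj_onI)
    fix z w assume zw: "z \<in> D" "w \<in> D" "(\<sigma> \<circ> p) z = (\<sigma> \<circ> p) w"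
    then have "p z = p w"
      using triangulation_inj[OF tri s] pS zw by simp
    then have "p z 0 = p w 0" "p z 1 = p w 1" by auto
    then show "z = w" by (simp add: p_def complex_eq_iff)
  qed
  ultimately have "(\<sigma> \<circ> p) ` D \<inter> surface_boundary X = {}"
    by (rule planar_image_misses_surface_boundary)
  moreover have "Complex (x 0) (x 1) \<in> D \<and> p (Complex (x 0) (x 1)) = x"
  proof -
    have nz: "x m \<noteq> 0" if "m \<le> 2" for m using x(2) that by (auto simp: face_support_def)
    show ?thesis
      using x(1) nz[of 0] nz[of 1] nz[of 2]
      by (auto simp: standard_simplex_2_iff D_def p_def fun_eq_iff)
  qed
  ultimately show ?thesis by (metis IntI comp_apply empty_iff imageI)
qed

lemma two_of_three:
  assumes "k \<le> (2::nat)"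
  obtains i j where "{..2} - {k} = {i, j}" "i \<le> 2" "j \<le> 2" "i \<noteq> j"
proof -
  have "k = 0 \<or> k = 1 \<or> k = 2" using assms by auto
  moreover have "{..2::nat} - {0} = {1, 2}" "{..2::nat} - {1} = {0, 2}" "{..2::nat} - {2} = {0, 1}" by auto
  ultimately show thesis using that[of 1 2] that[of 0 2] that[of 0 1] by auto
qed

text \<open>
  The neighbourhood consists of the points that lie on no closed side avoiding the given point. A
  boundary point in it lies on some closed side, since the open triangles contain no boundary points.
  That side passes through the given point, hence is glued to the given edge along its whole length.
\<close>

lemma boundary_near_edge:
  assumes haus: "Hausdorff_space X" and tri: "surface_triangulation X T" and s: "\<sigma> \<in> T"
    and ij: "i \<le> 2" "j \<le> 2" "i \<noteq> j" and t: "0 < t" "t < 1"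
  shows "\<exists>V. openin X V \<and> \<sigma> (edge_point i j t) \<in> V \<and>
           V \<inter> surface_boundary X \<subseteq> (\<lambda>u. \<sigma> (edge_point i j u)) ` {0..1}"
proof -
  let ?p = "\<sigma> (edge_point i j t)"
  define side where "side k = {z \<in> standard_simplex 2. z k = 0}" for k :: nat
  define F where "F = {(\<tau>, k). \<tau> \<in> T \<and> k \<le> (2::nat) \<and> ?p \<notin> \<tau> ` side k}"
  define K where "K = (\<Union>(\<tau>, k)\<in>F. \<tau> ` side k)"
  have "closedin (powertop_real UNIV) (side k)" for k
  proof -
    have "closedin (powertop_real UNIV) {z \<in> topspace (powertop_real UNIV). z k \<in> {0}}"
      by (intro closedin_continuous_map_preimage[where Y = euclideanreal]
           continuous_map_product_projection) auto
    then have "closedin (powertop_real UNIV) (standard_simplex 2 \<inter> {z. z k = (0::real)})"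
      using closedin_standard_simplex by (intro closedin_Int) simp_all
    moreover have "standard_simplex 2 \<inter> {z. z k = 0} = side k" by (auto simp: side_def)
    ultimately show ?thesis by simp
  qed
  then have "closedin X (\<tau> ` side k)" if "\<tau> \<in> T" for \<tau> k
    using closedin_triangle_image[OF haus tri that] by (auto simp: side_def)
  moreover have "finite F"
  proof (rule finite_subset)
    show "F \<subseteq> T \<times> {..2}" by (auto simp: F_def)
    show "finite (T \<times> {..2::nat})" using tri by (simp add: surface_triangulation_def)
  qed
  ultimately have K: "closedin X K"
    unfolding K_def by (intro closedin_Union) (auto simp: F_def)
  have x: "edge_point i j t \<in> standard_simplex 2" "face_support (edge_point i j t) = {i, j}"
    using edge_point_in_simplex[of i j t] face_support_edge_point[of i j t] ij t by auto
  have top: "topspace X = (\<Union>\<tau>\<in>T. \<tau> ` standard_simplex 2)"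
    using tri by (simp add: surface_triangulation_def)
  show ?thesis
  proof (intro exI[of _ "topspace X - K"] conjI subsetI)
    show "openin X (topspace X - K)" using K by blast
    show "?p \<in> topspace X - K"
      using x s top by (auto simp: K_def F_def)
    fix q assume q: "q \<in> (topspace X - K) \<inter> surface_boundary X"
    then obtain \<tau> y where y: "\<tau> \<in> T" "y \<in> standard_simplex 2" "q = \<tau> y" using top by auto
    have "face_support y \<noteq> {..2}"
      using open_triangle_misses_surface_boundary[OF tri y(1,2)] q y(3) by auto
    moreover have "face_support y \<subseteq> {..2}"
      using face_support_subset[OF y(2)] .
    ultimately obtain k where k: "k \<le> 2" "y k = 0" by (auto simp: face_support_def)
    then have "q \<in> \<tau> ` side k" using y by (auto simp: side_def)
    with q k y have "?p \<in> \<tau> ` side k" by (auto simp: K_def F_def)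
    then obtain z where z: "z \<in> standard_simplex 2" "z k = 0" "?p = \<tau> z" by (auto simp: side_def)
    obtain \<pi> where p: "\<pi> permutes {..2}" "z = edge_point i j t \<circ> \<pi>"
      and glue: "\<And>w. w \<in> standard_simplex 2 \<Longrightarrow> face_support w \<subseteq> {i, j} \<Longrightarrow> \<sigma> w = \<tau> (w \<circ> \<pi>)"
      using triangulation_glue[OF tri s y(1) x(1) z(1,3)] x(2) by metis
    have pk: "\<pi> k \<notin> {i, j}"
      using z(2) x(2) by (auto simp: p(2) face_support_def)
    have "\<pi> k \<le> 2" using permutes_in_image[OF p(1)] k(1) by auto
    then have only: "m = \<pi> k" if "m \<le> 2" "m \<notin> {i, j}" for m using pk ij that by auto
    \<comment> \<open>\<open>y'\<close> is the point of the edge of \<open>\<sigma>\<close> that is glued to \<open>y\<close>.\<close>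
    define y' where "y' = y \<circ> inv_into UNIV \<pi>"
    have y': "y' \<in> standard_simplex 2"
      unfolding y'_def using y(2) permutes_inv[OF p(1)] by (rule standard_simplex_permute)
    have "face_support y' \<subseteq> {i, j}"
    proof (rule ccontr)
      assume "\<not> face_support y' \<subseteq> {i, j}"
      then obtain m where m: "y' m \<noteq> 0" "m \<notin> {i, j}" by (auto simp: face_support_def)
      moreover have "m \<le> 2" using m(1) face_support_subset[OF y'] by (auto simp: face_support_def)
      ultimately have "inv_into UNIV \<pi> m = k" using only permutes_inverses(2)[OF p(1)] by metis
      then show False using m k by (simp add: y'_def)
    qed
    moreover have "y' \<circ> \<pi> = y" using permutes_inverses(2)[OF p(1)] by (auto simp: y'_def)
    ultimately have "q = \<sigma> y'" "y' = edge_point i j (y' j)" "y' j \<in> {0..1}"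
      using glue[OF y'] y(3) edge_point_of_support[OF y' _ ij] by auto
    then show "q \<in> (\<lambda>u. \<sigma> (edge_point i j u)) ` {0..1}" by (metis imageI)
  qed
qed

text \<open>
  A boundary point lies on some side of a triangle. If neither end point of the side were on the
  boundary, the arc lemma would keep the whole side off it.
\<close>

lemma boundary_vertex_exists:
  assumes "bordered_triangulated_surface X T"
  shows "boundary_vertices X T \<noteq> {}"
proof
  assume none: "boundary_vertices X T = {}"
  let ?B = "surface_boundary X"
  have X: "topological_surface X" and haus: "Hausdorff_space X" and tri: "surface_triangulation X T"
    and "?B \<noteq> {}"
    using assms by (auto simp: bordered_triangulated_surface_def topological_surface_def)
  then obtain b where b: "b \<in> ?B" by blast
  then obtain \<sigma> x where s: "\<sigma> \<in> T" and x: "x \<in> standard_simplex 2" "b = \<sigma> x"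
    using tri by (auto simp: surface_triangulation_def surface_boundary_def)
  have vert: "simplicial_vertex i \<sigma> \<notin> ?B" if "i \<le> 2" for i
    using none s that by (auto simp: boundary_vertices_def tri_vertices_def)
  have "face_support x \<noteq> {..2}"
    using open_triangle_misses_surface_boundary[OF tri s x(1)] b x(2) by auto
  moreover have sub: "face_support x \<subseteq> {..2}"
    using face_support_subset[OF x(1)] .
  ultimately obtain k where k: "k \<le> 2" "k \<notin> face_support x" by blast
  then obtain i j where ijk: "{..2} - {k} = {i, j}" and ij: "i \<le> 2" "j \<le> 2" "i \<noteq> j"
    using two_of_three by metis
  define e where "e = (\<lambda>t. \<sigma> (edge_point i j t))"
  have e01: "e 0 = simplicial_vertex i \<sigma>" "e 1 = simplicial_vertex j \<sigma>"
    using ij by (simp_all add: e_def edge_point_ends)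
  have ends: "e 0 \<notin> ?B" "e 1 \<notin> ?B" using vert ij by (simp_all add: e01)
  have "e ` {0..1} \<inter> ?B = {}"
  proof (rule surface_boundary_misses_arc[OF X _ _ ends])
    have "continuous_map (top_of_set {0..1}) euclideanreal (\<lambda>t. edge_point i j t m)" for m
      unfolding edge_point_def by (cases "m = i"; cases "m = j") (auto intro!: continuous_intros)
    then have "continuous_map (top_of_set {0..1})
        (subtopology (powertop_real UNIV) (standard_simplex 2)) (edge_point i j)"
      using edge_point_in_simplex[OF ij]
      by (auto simp: continuous_map_in_subtopology continuous_map_componentwise_UNIV)
    from continuous_map_compose[OF this triangulation_continuous[OF tri s]]
    show "continuous_map (top_of_set {0..1}) X e" by (simp add: e_def comp_def)
    show "inj_on e {0<..<1}"
    proof (rule inj_onI)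
      fix t u :: real assume tu: "t \<in> {0<..<1}" "u \<in> {0<..<1}" "e t = e u"
      have mem: "edge_point i j t \<in> standard_simplex 2" "edge_point i j u \<in> standard_simplex 2"
        using tu edge_point_in_simplex[OF ij] by auto
      have "face_support (edge_point i j t) = face_support (edge_point i j u)"
        using tu ij by (simp add: face_support_edge_point)
      then have "edge_point i j t = edge_point i j u"
        using triangulation_inj[OF tri s mem] tu(3) by (simp add: e_def)
      then have "edge_point i j t i = edge_point i j u i" by simp
      then show "t = u" by (simp add: edge_point_def)
    qed
    show "\<exists>V. openin X V \<and> e t \<in> V \<and> V \<inter> ?B \<subseteq> e ` {0<..<1}" if t: "0 < t" "t < 1" for t
    proof -
      obtain V where V: "openin X V" "e t \<in> V" "V \<inter> ?B \<subseteq> e ` {0..1}"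
        using boundary_near_edge[OF haus tri s ij t] unfolding e_def by blast
      have "V \<inter> ?B \<subseteq> e ` {0<..<1}"
      proof
        fix q assume q: "q \<in> V \<inter> ?B"
        then obtain u where u: "u \<in> {0..1}" "q = e u" using V by blast
        then have "u \<noteq> 0" "u \<noteq> 1" using q ends by auto
        then show "q \<in> e ` {0<..<1}" using u by auto
      qed
      then show ?thesis using V by blast
    qed
  qed
  moreover have "face_support x \<subseteq> {i, j}" using sub k ijk by blast
  from edge_point_of_support[OF x(1) this ij] have "b \<in> e ` {0..1}"
    unfolding e_def x(2) by (metis imageI)
  ultimately show False using b by blast
qed

text \<open>
  Every set of vertices that is closed under passing to another vertex of the same triangle splits the
  triangles into those with all and those with none of their vertices in the set. The two parts cover the
  surface by closed sets, and they are disjoint: wherever two triangles meet, they share a vertex.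
\<close>

lemma vertices_linked_by_triangles:
  assumes haus: "Hausdorff_space X" and tri: "surface_triangulation X T" and conn: "connected_space X"
    and M: "M \<subseteq> tri_vertices T" "M \<noteq> {}"
    and step: "\<And>\<sigma> i j. \<lbrakk>\<sigma> \<in> T; i \<le> 2; j \<le> 2; simplicial_vertex i \<sigma> \<in> M\<rbrakk> \<Longrightarrow> simplicial_vertex j \<sigma> \<in> M"
  shows "M = tri_vertices T"
proof -
  define A where "A = {\<sigma> \<in> T. simplicial_vertex 0 \<sigma> \<in> M}"
  let ?im = "\<lambda>R. \<Union>\<sigma>\<in>R. \<sigma> ` standard_simplex 2"
  have inM: "simplicial_vertex i \<sigma> \<in> M \<longleftrightarrow> \<sigma> \<in> A" if "\<sigma> \<in> T" "i \<le> 2" for \<sigma> i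
    using step[of \<sigma> i 0] step[of \<sigma> 0 i] that by (auto simp: A_def)
  have fin: "finite T" and top: "topspace X = ?im T" using tri by (auto simp: surface_triangulation_def)
  have cl: "closedin X (?im R)" if "R \<subseteq> T" for R
  proof (intro closedin_Union)
    show "finite ((\<lambda>\<sigma>. \<sigma> ` standard_simplex 2) ` R)" using fin that finite_subset by blast
    show "closedin X C" if C: "C \<in> (\<lambda>\<sigma>. \<sigma> ` standard_simplex 2) ` R" for C
      using C \<open>R \<subseteq> T\<close> closedin_triangle_image[OF haus tri _ closedin_standard_simplex] by auto
  qed
  have "?im A \<inter> ?im (T - A) = {}"
  proof (rule ccontr)
    assume "?im A \<inter> ?im (T - A) \<noteq> {}"
    then obtain \<sigma> \<tau> x y where st: "\<sigma> \<in> A" "\<tau> \<in> T - A" "x \<in> standard_simplex 2"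
      "y \<in> standard_simplex 2" "\<sigma> x = \<tau> y" by auto
    then have sT: "\<sigma> \<in> T" "\<tau> \<in> T" by (auto simp: A_def)
    obtain \<pi> where p: "\<pi> permutes {..2}"
      and glue: "\<And>z. z \<in> standard_simplex 2 \<Longrightarrow> face_support z \<subseteq> face_support x \<Longrightarrow> \<sigma> z = \<tau> (z \<circ> \<pi>)"
      using triangulation_glue[OF tri sT st(3-5)] by metis
    obtain i where i: "i \<le> 2" "x i \<noteq> 0"
      using st(3) unfolding standard_simplex_def mem_Collect_eq
      by (metis (no_types, lifting) atMost_iff sum.neutral zero_neq_one)
    \<comment> \<open>the vertex of \<open>\<tau>\<close> that is glued to the vertex \<open>i\<close> of \<open>\<sigma>\<close>\<close>
    define i' where "i' = inv_into UNIV \<pi> i"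
    have i': "i' \<le> 2" "\<pi> i' = i"
      using permutes_in_image[OF permutes_inv[OF p], of i] permutes_inverses(1)[OF p] i by (auto simp: i'_def)
    have "(\<lambda>m. if m = i then 1 else 0) \<circ> \<pi> = (\<lambda>m. if m = i' then 1 else (0::real))"
      using permutes_inj[OF p] i' by (auto simp: fun_eq_iff inj_eq)
    moreover have "face_support (\<lambda>m. if m = i then 1 else 0) \<subseteq> face_support x"
      using i by (auto simp: face_support_def)
    ultimately have "simplicial_vertex i \<sigma> = simplicial_vertex i' \<tau>"
      using glue[of "\<lambda>m. if m = i then 1 else 0"] i by (simp add: simplicial_vertex_def)
    then show False using inM sT st(1,2) i i' by (metis Diff_iff)
  qed
  moreover have "?im A \<union> ?im (T - A) = topspace X" using top by (auto simp: A_def)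
  moreover have "A \<noteq> {}" using M inM by (force simp: tri_vertices_def)
  then have "?im A \<noteq> {}" using nonempty_standard_simplex by auto
  moreover have "closedin X (?im A)" "closedin X (?im (T - A))" by (auto intro!: cl simp: A_def)
  ultimately have "?im (T - A) = {}"
    using conn unfolding connected_space_closedin_eq by metis
  then have "T - A = {}" using nonempty_standard_simplex by auto
  then show ?thesis using M inM by (auto simp: tri_vertices_def)
qed

section \<open>The maximum principle\<close>

text \<open>
  The curvature at a vertex is a constant minus the sum of the weighted angles of its corners.
\<close>

definition weighted_angle :: "real \<Rightarrow> real \<Rightarrow> real" where
  "weighted_angle h \<theta> = (LBINT t=ereal (pi / 2)..ereal \<theta>. tan (t / 2) powr h)"

lemma weighted_angle_strict_mono:
  assumes "0 < a" "a < b" "b < pi"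
  shows "weighted_angle h a < weighted_angle h b"
proof -
  \<comment> \<open>The integral starts at \<open>pi / 2\<close>, which may lie on either side of \<open>a\<close> and \<open>b\<close>.\<close>
  define l u where "l = min a (pi / 2)" and "u = max b (pi / 2)"
  have lu: "0 < l" "l \<le> a" "l \<le> pi / 2" "pi / 2 \<le> u" "b \<le> u" "u < pi"
    using assms by (auto simp: l_def u_def)
  have pos: "0 < tan (t / 2)" "cos (t / 2) \<noteq> 0" if "t \<in> {l..u}" for t
    using that lu by (auto intro!: tan_gt_zero simp: less_imp_neq[OF cos_gt_zero, symmetric])
  have cont: "continuous_on {l..u} (\<lambda>t. tan (t / 2) powr h)"
    using pos by (intro continuous_intros) (auto simp: less_imp_neq[symmetric])
  have d: "(weighted_angle h has_real_derivative tan (x / 2) powr h) (at x within {l..u})"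
    if "x \<in> {l..u}" for x
    using interval_integral_FTC2[OF lu(3,4) cont, of x] that
    unfolding weighted_angle_def has_real_derivative_iff_has_vector_derivative by simp
  show ?thesis
  proof (rule DERIV_pos_imp_increasing_open[OF assms(2)])
    show "\<exists>y. (weighted_angle h has_real_derivative y) (at x) \<and> 0 < y" if "a < x" "x < b" for x
    proof -
      have x: "x \<in> {l<..<u}" using that lu by auto
      then have "at x within {l..u} = at x" by (intro at_within_interior) auto
      then show ?thesis using d[of x] pos(1)[of x] x by auto
    qed
    have "continuous_on {l..u} (weighted_angle h)"
      using d by (rule DERIV_continuous_on)
    then show "continuous_on {a..b} (weighted_angle h)"
      by (rule continuous_on_subset) (use lu in auto)
  qed
qed

text \<open>
  The size \<open>f r\<close> of a circle of radius \<open>r\<close> is chosen so that enlarging all sizes by a common factor never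
  enlarges an angle. By \<open>1 - 2 sin\<^sup>2 (\<theta>/2) = cos \<theta>\<close>, the last property says that \<open>sin\<^sup>2 (\<theta>/2)\<close> is the product
  of one factor \<open>P\<close> for each of the two neighbouring circles. The bounds on \<open>P\<close> keep \<open>\<theta>\<close> strictly between
  \<open>0\<close> and \<open>pi\<close>, where \<open>tan (\<theta>/2)\<close> is positive and finite.
\<close>

locale packing_angle =
  fixes ang :: "real \<Rightarrow> real \<Rightarrow> real \<Rightarrow> real" and f :: "real \<Rightarrow> real" and P :: "real \<Rightarrow> real \<Rightarrow> real"
  assumes size_pos: "0 < r \<Longrightarrow> 0 < f r"
    and size_le_iff: "0 < r \<Longrightarrow> 0 < s \<Longrightarrow> f r \<le> f s \<longleftrightarrow> r \<le> s"
    and factor_pos: "0 < x \<Longrightarrow> 0 < y \<Longrightarrow> 0 < P x y"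
    and factor_less_1: "0 < x \<Longrightarrow> 0 < y \<Longrightarrow> P x y < 1"
    and factor_strict_mono: "0 < x \<Longrightarrow> 0 < y \<Longrightarrow> y < z \<Longrightarrow> P x y < P x z"
    and factor_scale: "0 < x \<Longrightarrow> 0 < y \<Longrightarrow> 1 \<le> c \<Longrightarrow> P (c * x) (c * y) \<le> P x y"
    and angle_eq: "0 < r \<Longrightarrow> 0 < s \<Longrightarrow> 0 < t \<Longrightarrow>
      ang (s + t) (r + s) (r + t) = arccos (1 - 2 * (P (f r) (f s) * P (f r) (f t)))"
begin

lemma factor_scaled_le:
  assumes "0 < x" "0 < y" "0 < y'" "1 \<le> c" "y \<le> c * y'"
  shows "P (c * x) y \<le> P x y'" "y < c * y' \<Longrightarrow> P (c * x) y < P x y'"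
proof -
  have s: "P (c * x) (c * y') \<le> P x y'" using assms factor_scale by simp
  have "0 < c * x" using assms by simp
  then have "P (c * x) y < P (c * x) (c * y')" if "y < c * y'"
    using that assms factor_strict_mono by simp
  with s show "y < c * y' \<Longrightarrow> P (c * x) y < P x y'" by simp
  with s assms(5) show "P (c * x) y \<le> P x y'" by (cases "y = c * y'") auto
qed

lemma angle_range:
  assumes "0 < r" "0 < s" "0 < t"
  shows "0 < ang (s + t) (r + s) (r + t)" "ang (s + t) (r + s) (r + t) < pi"
proof -
  let ?p = "P (f r) (f s) * P (f r) (f t)"
  have "0 < ?p" using assms by (simp add: factor_pos size_pos)
  moreover have "?p < 1 * 1"
    using assms by (intro mult_strict_mono) (simp_all add: factor_pos factor_less_1 size_pos less_imp_le)
  ultimately show "0 < ang (s + t) (r + s) (r + t)" "ang (s + t) (r + s) (r + t) < pi"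
    using arccos_lt_bounded[of "1 - 2 * ?p"] assms by (simp_all add: angle_eq)
qed

text \<open>
  Both factors of \<open>sin\<^sup>2\<close> of the half angle can only grow from the unprimed to the primed triangle, so
  equality of the angles forces equality of both factors, and with it proportional sizes.
\<close>

lemma angle_comparison:
  assumes pos: "0 < r" "0 < s" "0 < t" "0 < r'" "0 < s'" "0 < t'" and c: "1 \<le> c"
    and le: "f r = c * f r'" "f s \<le> c * f s'" "f t \<le> c * f t'"
  shows "ang (s + t) (r + s) (r + t) \<le> ang (s' + t') (r' + s') (r' + t')"
    and "ang (s + t) (r + s) (r + t) = ang (s' + t') (r' + s') (r' + t') \<Longrightarrow>
           f s = c * f s' \<and> f t = c * f t'"
proof -
  define p q p' q' where "p = P (f r) (f s)" and "q = P (f r) (f t)"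
    and "p' = P (f r') (f s')" and "q' = P (f r') (f t')"
  note defs = p_def q_def p'_def q'_def
  have b: "0 < p" "0 < q" "p' < 1" "q' < 1" "0 < p'" "0 < q'"
    using pos by (simp_all add: defs factor_pos factor_less_1 size_pos)
  have pp: "p \<le> p'" "f s < c * f s' \<Longrightarrow> p < p'" and qq: "q \<le> q'" "f t < c * f t' \<Longrightarrow> q < q'"
    unfolding defs le(1) using pos c le by (auto intro!: factor_scaled_le simp: size_pos)
  have m: "p * q \<le> p' * q'" using b pp qq by (intro mult_mono) auto
  have m1: "p' * q' < 1 * 1" using b by (intro mult_strict_mono) auto
  have m0: "0 < p * q" using b by simp
  have e: "ang (s + t) (r + s) (r + t) = arccos (1 - 2 * (p * q))"
    "ang (s' + t') (r' + s') (r' + t') = arccos (1 - 2 * (p' * q'))"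
    using pos by (simp_all add: angle_eq defs)
  show "ang (s + t) (r + s) (r + t) \<le> ang (s' + t') (r' + s') (r' + t')"
    unfolding e using m m0 m1 by (intro arccos_le_arccos) auto
  assume "ang (s + t) (r + s) (r + t) = ang (s' + t') (r' + s') (r' + t')"
  then have "1 - 2 * (p * q) = 1 - 2 * (p' * q')"
    unfolding e using m m0 m1 by (subst (asm) arccos_eq_iff) auto
  then have eq: "p * q = p' * q'" by simp
  have "\<not> p < p'"
  proof
    assume "p < p'"
    then have "p * q < p' * q'" using b qq by (intro mult_less_le_imp_less) auto
    then show False using eq by simp
  qed
  moreover have "\<not> q < q'"
  proof
    assume "q < q'"
    then have "p * q < p' * q'" using b pp by (intro mult_le_less_imp_less) auto
    then show False using eq by simp
  qed
  ultimately show "f s = c * f s' \<and> f t = c * f t'" using pp qq le by force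
qed

text \<open>
  If \<open>r\<close> exceeded \<open>r'\<close> somewhere, the set \<open>M\<close> of the vertices where the ratio of the sizes is maximal
  would avoid \<open>B\<close> and be closed under passing to neighbours, whereas \<open>linked\<close> says that such a set
  contains every vertex.
\<close>

lemma radius_comparison:
  assumes fin: "finite T" and r: "circle_packing_metric T r" and r': "circle_packing_metric T r'"
    and linked: "\<And>M. \<lbrakk>M \<subseteq> tri_vertices T; M \<noteq> {};
        \<And>\<sigma> i j. \<lbrakk>\<sigma> \<in> T; i \<le> 2; j \<le> 2; simplicial_vertex i \<sigma> \<in> M\<rbrakk> \<Longrightarrow> simplicial_vertex j \<sigma> \<in> M\<rbrakk>
        \<Longrightarrow> M = tri_vertices T"
    and B: "B \<inter> tri_vertices T \<noteq> {}" "\<And>v. v \<in> B \<inter> tri_vertices T \<Longrightarrow> r v = r' v"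
    and curv: "\<And>v. v \<in> tri_vertices T - B \<Longrightarrow> k_curvature ang T h r v = k_curvature ang T h r' v"
    and v: "v \<in> tri_vertices T"
  shows "r v \<le> r' v"
proof (rule ccontr)
  let ?V = "tri_vertices T"
  define Q where "Q w = f (r w) / f (r' w)" for w
  define c where "c = Max (Q ` ?V)"
  define M where "M = {w \<in> ?V. Q w = c}"
  have pos: "0 < r w" "0 < r' w" "0 < f (r w)" "0 < f (r' w)" if "w \<in> ?V" for w
    using r r' that size_pos by (auto simp: circle_packing_metric_def)
  have finV: "finite ?V"
  proof (rule finite_subset)
    show "?V \<subseteq> (\<lambda>(\<sigma>, i). simplicial_vertex i \<sigma>) ` (T \<times> {..2})" by (auto simp: tri_vertices_def)
  qed (use fin in simp)
  have Qc: "Q w \<le> c" if "w \<in> ?V" for w using that finV by (simp add: c_def)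
  then have le: "f (r w) \<le> c * f (r' w)" if "w \<in> ?V" for w
    using Qc[OF that] pos[OF that] by (simp add: Q_def pos_divide_le_eq)
  have M_iff: "w \<in> M \<longleftrightarrow> w \<in> ?V \<and> f (r w) = c * f (r' w)" for w
    using pos[of w] by (auto simp: M_def Q_def field_simps)
  assume "\<not> r v \<le> r' v"
  then have "1 < Q v" using pos[OF v] size_le_iff[of "r v" "r' v"] by (simp add: Q_def)
  then have c: "1 < c" using Qc[OF v] by simp
  have MB: "M \<inter> B = {}"
  proof (rule ccontr)
    assume "M \<inter> B \<noteq> {}"
    then obtain w where "w \<in> M" "w \<in> B" by blast
    then have "f (r' w) = c * f (r' w)" "w \<in> ?V" using B(2)[of w] by (auto simp: M_iff)
    then show False using pos[of w] c by simp
  qed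
  have "M = ?V"
  proof (rule linked)
    show "M \<subseteq> ?V" by (auto simp: M_def)
    have "c \<in> Q ` ?V" unfolding c_def using finV v by (intro Max_in) auto
    then show "M \<noteq> {}" by (auto simp: M_def)
    fix \<sigma> i j assume s: "\<sigma> \<in> T" "i \<le> (2::nat)" "j \<le> (2::nat)" and iM: "simplicial_vertex i \<sigma> \<in> M"
    define w where "w = simplicial_vertex i \<sigma>"
    define C where "C = corners_at T w"
    define \<theta> where "\<theta> \<rho> = (\<lambda>(\<tau>, k). corner_angle ang \<rho> \<tau> k)" for \<rho> :: "'a \<Rightarrow> real"
    have wM: "w \<in> M" using iM by (simp add: w_def)
    then have wV: "w \<in> ?V" and wB: "w \<notin> B" using MB by (auto simp: M_def)
    have finC: "finite C"
    proof (rule finite_subset)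
      show "C \<subseteq> T \<times> {..2}" by (auto simp: C_def corners_at_def)
    qed (use fin in simp)
    have inV: "simplicial_vertex k \<tau> \<in> ?V" if "\<tau> \<in> T" "k \<le> 2" for \<tau> k
      using that by (auto simp: tri_vertices_def)
    \<comment> \<open>The other two vertices of a corner may coincide with each other or with \<open>w\<close>; the comparison
      uses only the radii there.\<close>
    have cmp: "0 < \<theta> r x \<and> \<theta> r x \<le> \<theta> r' x \<and> \<theta> r' x < pi \<and> (\<theta> r x = \<theta> r' x \<longrightarrow>
        simplicial_vertex ((snd x + 1) mod 3) (fst x) \<in> M \<and> simplicial_vertex ((snd x + 2) mod 3) (fst x) \<in> M)"
      if xC: "x \<in> C" for x
    proof -
      obtain \<tau> k where x: "x = (\<tau>, k)" "\<tau> \<in> T" "k \<le> 2" "simplicial_vertex k \<tau> = w"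
        using xC by (auto simp: C_def corners_at_def)
      define a b where "a = simplicial_vertex ((k + 1) mod 3) \<tau>" and "b = simplicial_vertex ((k + 2) mod 3) \<tau>"
      have m3: "m mod 3 \<le> 2" for m :: nat by presburger
      have ab: "a \<in> ?V" "b \<in> ?V" using inV[OF x(2)] m3 by (simp_all add: a_def b_def)
      have th: "\<theta> \<rho> x = ang (\<rho> a + \<rho> b) (\<rho> w + \<rho> a) (\<rho> w + \<rho> b)" for \<rho>
        by (simp add: \<theta>_def x corner_angle_def Let_def side_length_def a_def b_def)
      have fw: "f (r w) = c * f (r' w)" using wM M_iff by blast
      note p = pos(1)[OF wV] pos(1)[OF ab(1)] pos(1)[OF ab(2)]
      note p' = pos(2)[OF wV] pos(2)[OF ab(1)] pos(2)[OF ab(2)]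
      note cmp = angle_comparison[OF p p' less_imp_le[OF c] fw le[OF ab(1)] le[OF ab(2)]]
      have "\<theta> r x = \<theta> r' x \<Longrightarrow> a \<in> M \<and> b \<in> M"
        unfolding th M_iff using cmp(2) ab by blast
      moreover have "0 < \<theta> r x \<and> \<theta> r x \<le> \<theta> r' x \<and> \<theta> r' x < pi"
        unfolding th using cmp(1) angle_range(1)[OF p] angle_range(2)[OF p'] by blast
      ultimately show ?thesis by (simp add: x(1) a_def b_def)
    qed
    have sums: "(\<Sum>x\<in>C. weighted_angle h (\<theta> r x)) = (\<Sum>x\<in>C. weighted_angle h (\<theta> r' x))"
      using curv[of w] wV wB
      by (simp add: k_curvature_def C_def \<theta>_def weighted_angle_def case_prod_unfold)
    have wle: "weighted_angle h (\<theta> r x) \<le> weighted_angle h (\<theta> r' x)" if "x \<in> C" for x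
      using cmp[OF that] weighted_angle_strict_mono[of "\<theta> r x" "\<theta> r' x" h] by fastforce
    have eq: "weighted_angle h (\<theta> r x) = weighted_angle h (\<theta> r' x)" if "x \<in> C" for x
      using sum_mono_inv[OF sums wle that finC] .
    have iC: "(\<sigma>, i) \<in> C" using s by (simp add: C_def corners_at_def w_def)
    have "\<theta> r (\<sigma>, i) = \<theta> r' (\<sigma>, i)"
      using cmp[OF iC] eq[OF iC] weighted_angle_strict_mono[of "\<theta> r (\<sigma>, i)" "\<theta> r' (\<sigma>, i)" h] by fastforce
    with cmp[OF iC] have "simplicial_vertex ((i + 1) mod 3) \<sigma> \<in> M" "simplicial_vertex ((i + 2) mod 3) \<sigma> \<in> M"
      by auto
    moreover have "i = 0 \<or> i = 1 \<or> i = 2" "j = 0 \<or> j = 1 \<or> j = 2" using s(2,3) by auto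
    then have "j = i \<or> j = (i + 1) mod 3 \<or> j = (i + 2) mod 3" by auto
    ultimately show "simplicial_vertex j \<sigma> \<in> M" using iM by auto
  qed
  then show False using MB B(1) by blast
qed

lemma rigidity:
  assumes S: "bordered_triangulated_surface X T" and conn: "connected_space X"
    and r: "circle_packing_metric T r" "circle_packing_metric T r'"
    and bd: "\<And>v. v \<in> boundary_vertices X T \<Longrightarrow> r v = r' v"
    and curv: "\<And>v. v \<in> interior_vertices X T \<Longrightarrow> k_curvature ang T h r v = k_curvature ang T h r' v"
    and v: "v \<in> tri_vertices T"
  shows "r v = r' v"
proof -
  have haus: "Hausdorff_space X" and tri: "surface_triangulation X T" and fin: "finite T"
    using S by (auto simp: bordered_triangulated_surface_def topological_surface_def
        surface_triangulation_def)
  let ?B = "surface_boundary X"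
  have B: "?B \<inter> tri_vertices T \<noteq> {}"
    using boundary_vertex_exists[OF S] by (simp add: boundary_vertices_def Int_commute)
  have bd': "r w = r' w" if "w \<in> ?B \<inter> tri_vertices T" for w
    using bd[of w] that by (simp add: boundary_vertices_def)
  have curv': "k_curvature ang T h r w = k_curvature ang T h r' w" if "w \<in> tri_vertices T - ?B" for w
    using curv[of w] that by (simp add: interior_vertices_def)
  note linked = vertices_linked_by_triangles[OF haus tri conn]
  show ?thesis
  proof (rule antisym)
    show "r v \<le> r' v"
      by (rule radius_comparison[OF fin r linked B bd' curv' v])
    show "r' v \<le> r v"
      by (rule radius_comparison[OF fin r(2,1) linked B bd'[symmetric] curv'[symmetric] v])
  qed
qed

end

section \<open>Euclidean and hyperbolic triangles\<close>

interpretation euclidean: packing_angle euclidean_angle "\<lambda>r. r" "\<lambda>x y. y / (x + y)"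
proof
  fix r s t :: real assume p: "0 < r" "0 < s" "0 < t"
  have "((r + s)\<^sup>2 + (r + t)\<^sup>2 - (s + t)\<^sup>2) / (2 * (r + s) * (r + t)) =
      1 - 2 * (s / (r + s) * (t / (r + t)))"
    using p by (simp add: divide_simps) (simp add: power2_eq_square algebra_simps)
  then show "euclidean_angle (s + t) (r + s) (r + t) = arccos (1 - 2 * (s / (r + s) * (t / (r + t))))"
    using p by (subst euclidean_law_of_cosines) auto
next
  fix x y c :: real assume "0 < x" "0 < y" "1 \<le> c"
  then show "c * y / (c * x + c * y) \<le> y / (x + y)"
    by (simp flip: distrib_left)
qed (auto simp: field_simps)

text \<open>
  This is \<open>sinh s / sinh (r + s)\<close> in terms of \<open>x = sinh r\<close> and \<open>y = sinh s\<close>.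
\<close>

definition hyperbolic_factor :: "real \<Rightarrow> real \<Rightarrow> real" where
  "hyperbolic_factor x y = y / (x * sqrt (1 + y\<^sup>2) + y * sqrt (1 + x\<^sup>2))"

lemma hyperbolic_factor_sinh:
  "hyperbolic_factor (sinh r) (sinh s) = sinh s / sinh (r + s)"
proof -
  have "sqrt (1 + (sinh x)\<^sup>2) = cosh x" for x :: real
    by (rule real_sqrt_unique) (simp_all add: cosh_square_eq add.commute)
  then show ?thesis by (simp add: hyperbolic_factor_def sinh_add add.commute mult.commute)
qed

text \<open>
  In this form the factor visibly increases with \<open>y\<close>.
\<close>

lemma hyperbolic_factor_alt:
  assumes "0 < x" "0 < y"
  shows "hyperbolic_factor x y = 1 / (x * sqrt (1 + (1 / y)\<^sup>2) + sqrt (1 + x\<^sup>2))"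
proof -
  have "sqrt (1 + y\<^sup>2) = y * sqrt (1 + (1 / y)\<^sup>2)"
    using assms by (intro real_sqrt_unique) (auto simp: power_mult_distrib field_simps)
  then have "x * sqrt (1 + y\<^sup>2) + y * sqrt (1 + x\<^sup>2) = y * (x * sqrt (1 + (1 / y)\<^sup>2) + sqrt (1 + x\<^sup>2))"
    by (simp add: algebra_simps)
  then show ?thesis using assms by (simp add: hyperbolic_factor_def)
qed

interpretation hyperbolic: packing_angle hyperbolic_angle sinh hyperbolic_factor
proof
  fix r s t :: real assume p: "0 < r" "0 < s" "0 < t"
  have "cosh (s + t) = cosh ((r + s) - (r + t)) + 2 * (sinh s * sinh t)"
    by (simp add: cosh_add cosh_diff)
  then have "cosh (r + s) * cosh (r + t) - cosh (s + t) =
      sinh (r + s) * sinh (r + t) - 2 * (sinh s * sinh t)"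
    unfolding cosh_diff by simp
  moreover have "0 < sinh (r + s)" "0 < sinh (r + t)" using p by (simp_all only: sinh_real_pos_iff)
  ultimately have "(cosh (r + s) * cosh (r + t) - cosh (s + t)) / (sinh (r + s) * sinh (r + t)) =
      1 - 2 * (sinh s / sinh (r + s) * (sinh t / sinh (r + t)))"
    by (simp add: field_simps)
  then show "hyperbolic_angle (s + t) (r + s) (r + t) =
      arccos (1 - 2 * (hyperbolic_factor (sinh r) (sinh s) * hyperbolic_factor (sinh r) (sinh t)))"
    unfolding hyperbolic_factor_sinh using p by (subst hyperbolic_law_of_cosines) auto
next
  fix x y :: real assume p: "0 < x" "0 < y"
  then have "y * 1 \<le> y * sqrt (1 + x\<^sup>2)" by (intro mult_left_mono) auto
  moreover have "0 < x * sqrt (1 + y\<^sup>2)" using p by (auto intro!: mult_pos_pos add_pos_nonneg)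
  ultimately have "y < x * sqrt (1 + y\<^sup>2) + y * sqrt (1 + x\<^sup>2)" by linarith
  then show "0 < hyperbolic_factor x y" "hyperbolic_factor x y < 1"
    using p by (simp_all add: hyperbolic_factor_def)
next
  fix x y z :: real assume p: "0 < x" "0 < y" "y < z"
  then have "(1 / z)\<^sup>2 < (1 / y)\<^sup>2" by (intro power_strict_mono divide_strict_left_mono) auto
  then have "x * sqrt (1 + (1 / z)\<^sup>2) < x * sqrt (1 + (1 / y)\<^sup>2)"
    using p by (intro mult_strict_left_mono) auto
  moreover have "0 < x * sqrt (1 + (1 / w)\<^sup>2) + sqrt (1 + x\<^sup>2)" for w
    using p by (intro add_pos_pos mult_pos_pos) (auto intro!: add_pos_nonneg)
  ultimately show "hyperbolic_factor x y < hyperbolic_factor x z"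
    using p by (auto simp: hyperbolic_factor_alt intro!: divide_strict_left_mono mult_pos_pos)
next
  fix x y c :: real assume p: "0 < x" "0 < y" "1 \<le> c"
  have sq: "sqrt (1 + z\<^sup>2) \<le> sqrt (1 + (c * z)\<^sup>2)" if "0 < z" for z
    using that p by (auto intro!: power_mono)
  define d d' where "d = x * sqrt (1 + y\<^sup>2) + y * sqrt (1 + x\<^sup>2)"
    and "d' = x * sqrt (1 + (c * y)\<^sup>2) + y * sqrt (1 + (c * x)\<^sup>2)"
  have "0 < d"
    unfolding d_def using p by (intro add_pos_pos mult_pos_pos) (auto intro!: add_pos_nonneg)
  moreover have "d \<le> d'"
    unfolding d_def d'_def using p sq by (intro add_mono mult_left_mono) auto
  moreover have "hyperbolic_factor (c * x) (c * y) = c * y / (c * d')"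
    by (simp add: hyperbolic_factor_def d'_def algebra_simps)
  then have "hyperbolic_factor (c * x) (c * y) = y / d'" using p by simp
  ultimately show "hyperbolic_factor (c * x) (c * y) \<le> hyperbolic_factor x y"
    using p by (auto simp: hyperbolic_factor_def d_def[symmetric] intro!: divide_left_mono)
qed auto


section \<open>Rigidity of circle packing metrics\<close>

theorem theorem1p10:
  fixes X :: "'a topology" and T :: "((nat \<Rightarrow> real) \<Rightarrow> 'a) set" and h :: real
  assumes "bordered_triangulated_surface X T" and "connected_space X"
  shows "(\<forall>r1 r2 :: 'a \<Rightarrow> real.
            circle_packing_metric T r1 \<and> circle_packing_metric T r2 \<and>
            (\<forall>v\<in>boundary_vertices X T. r1 v = r2 v) \<and>
            (\<forall>v\<in>interior_vertices X T.
               k_curvature euclidean_angle T h r1 v = k_curvature euclidean_angle T h r2 v)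
            \<longrightarrow> (\<forall>v\<in>tri_vertices T. r1 v = r2 v)) \<and>
         (\<forall>r1 r2 :: 'a \<Rightarrow> real.
            circle_packing_metric T r1 \<and> circle_packing_metric T r2 \<and>
            (\<forall>v\<in>boundary_vertices X T. r1 v = r2 v) \<and>
            (\<forall>v\<in>interior_vertices X T.
               k_curvature hyperbolic_angle T h r1 v = k_curvature hyperbolic_angle T h r2 v)
            \<longrightarrow> (\<forall>v\<in>tri_vertices T. r1 v = r2 v))"
  using euclidean.rigidity[OF assms, of _ _ h] hyperbolic.rigidity[OF assms, of _ _ h] by blast

end
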